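(* Let $E(q)=(q;q)_\infty$, $R(q)=\frac{(q,q^4;q^5)_\infty}{(q^2,q^3;q^5)_\infty}$, $\mu(q)=qR(q)R(q^4)$ and $\nu(q^2)=\frac{R(q)^2R(q^2)}{R(q^4)}$. Then, as identities of formal Laurent series in $q$, $$\frac{1}{\mu(q)}-\mu(q)=\frac{E(q^2)^3E(q^{10})^5}{qE(q)E(q^4)E(q^5)^3E(q^{20})^3}$$ and $$\frac{1}{\nu(q^2)}-\nu(q^2)=\frac{4qE(q^4)E(q^{20})^3}{E(q^{10})^4}.$$
   Context: $(A;q)_\infty=\prod_{k\ge0}(1-Aq^k)$, $(A_1,\dots,A_n;q)_\infty=\prod_i(A_i;q)_\infty$. $\mu$ and $\nu$ are Ramanujan's parameters; $\nu(q)=R(q^{1/2})^2R(q)/R(q^2)$, so $\nu(q^2)$ is as stated. *)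

theory Defs
  imports "HOL-Analysis.Analysis" "HOL-Computational_Algebra.Formal_Laurent_Series"
begin

text \<open>
  Everything is a formal Laurent series over the complex numbers. The argument \<open>q\<close> of the
  functions below is a series (a positive power of \<open>fls_X\<close>), so that e.g. \<open>R (q ^ 4)\<close> is
  literally the substitution of \<open>q ^ 4\<close> for \<open>q\<close>. The infinite product is the library's
  \<open>prodinf\<close>, taken with respect to the \<open>q\<close>-adic metric on \<open>complex fls\<close>.
\<close>

definition qpoch_inf :: "complex fls \<Rightarrow> complex fls \<Rightarrow> complex fls" where
  "qpoch_inf A q = (\<Prod>k. 1 - A * q ^ k)"

definition E :: "complex fls \<Rightarrow> complex fls" where
  "E q = qpoch_inf q q"

definition R :: "complex fls \<Rightarrow> complex fls" where
  "R q = (qpoch_inf q (q ^ 5) * qpoch_inf (q ^ 4) (q ^ 5)) /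
         (qpoch_inf (q ^ 2) (q ^ 5) * qpoch_inf (q ^ 3) (q ^ 5))"

definition mu :: "complex fls \<Rightarrow> complex fls" where
  "mu q = q * R q * R (q ^ 4)"

text \<open>
  \<open>nu_sq q\<close> is $\nu(q^2)$. Ramanujan's parameter $\nu(q) = R(q^{1/2})^2 R(q) / R(q^2)$ itself
  involves $q^{1/2}$; only its value at $q^2$ is needed.
\<close>

definition nu_sq :: "complex fls \<Rightarrow> complex fls" where
  "nu_sq q = R q ^ 2 * R (q ^ 2) / R (q ^ 4)"

text \<open>The defining products do converge, so \<open>prodinf\<close> is not a junk value here.\<close>

lemma dist_fps_to_fls: "dist (fps_to_fls f) (fps_to_fls g) = dist f (g :: 'a :: ab_group_add fps)"
proof -
  have "fps_to_fls f - fps_to_fls g = fps_to_fls (f - g)"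
    by (intro fls_eqI) simp
  then have "fls_subdegree (fps_to_fls f - fps_to_fls g) = int (subdegree (f - g))"
    by (simp only: fls_subdegree_fls_to_fps)
  then show ?thesis
    by (simp add: dist_fls_def dist_fps_def)
qed

lemma fps_to_fls_prod: "fps_to_fls (prod f A) = (\<Prod>k\<in>A. fps_to_fls (f k :: complex fps))"
  by (induction A rule: infinite_finite_induct) (auto simp: fls_times_fps_to_fls)

lemma has_prod_qpoch_inf:
  assumes "a > 0" "m > 0"
  shows "(\<lambda>k. 1 - fls_X ^ a * (fls_X ^ m) ^ k) has_prod qpoch_inf (fls_X ^ a) (fls_X ^ m)"
proof -
  define f :: "nat \<Rightarrow> complex fps" where "f = (\<lambda>k. 1 - fps_X ^ (a + m * k))"
  have nth0: "fps_nth (f k) 0 = 1" for k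
    using assms by (simp add: f_def)
  have nz: "f k \<noteq> 0" for k
    using nth0[of k] by auto
  have "subdegree (f k - 1) > n" if "k > n" for n k
  proof -
    have "k \<le> m * k"
      using assms by simp
    moreover have "subdegree (f k - 1) = a + m * k"
      by (simp add: f_def)
    ultimately show ?thesis
      using that by linarith
  qed
  from tendsto_prod_fps[of f "\<lambda>n. n", OF nz this] obtain P
    where P: "(\<lambda>n. \<Prod>k\<le>n. f k) \<longlonglongrightarrow> P"
    by blast
  have "(\<lambda>n. fps_nth (\<Prod>k\<le>n. f k) 0) \<longlonglongrightarrow> fps_nth P 0"
    using P unfolding tendsto_fps_iff by (auto intro: tendsto_eventually)
  moreover have "fps_nth (\<Prod>k\<le>n. f k) 0 = 1" for n
    by (induction n) (simp_all add: nth0)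
  ultimately have "fps_nth P 0 = 1"
    by (simp add: LIMSEQ_const_iff)
  then have Pnz: "fps_to_fls P \<noteq> 0"
    by auto
  have "(\<lambda>n. fps_to_fls (\<Prod>k\<le>n. f k)) \<longlonglongrightarrow> fps_to_fls P"
    using P unfolding tendsto_iff by (simp add: dist_fps_to_fls)
  moreover have "fps_to_fls (f k) = 1 - fls_X ^ a * (fls_X ^ m) ^ k" for k
    by (simp add: f_def fps_to_fls_power flip: power_mult power_add)
  ultimately have hp: "(\<lambda>k. 1 - fls_X ^ a * (fls_X ^ m) ^ k) has_prod fps_to_fls P"
    using Pnz by (simp add: has_prod_def raw_has_prod_def fps_to_fls_prod)
  then show ?thesis
    using has_prod_unique[OF hp] by (simp add: qpoch_inf_def)
qed

end

theory Submission
  imports Defs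
begin

text \<open>
  Write $j(z) = (z, q^{10}/z, q^{10}; q^{10})_\infty$. Splitting the products modulo 10 gives
  $\mu(q) = q\,j(q)\,j(-q^2) / (j(q^3)\,j(-q^4))$ and
  $\nu(q^2) = j(q)\,j(-q^3) / (j(q^3)\,j(-q))$. By the Jacobi triple product each $j$ is a theta
  series, and summing the product of two theta series over pairs of integers of equal and of
  opposite parity separately (after a rotation of the index lattice) gives Ramanujan's formula
  $f(a,b) f(c,d) = f(ac,bd) f(ad,bc) + a f(b/c, ac^2d) f(b/d, acd^2)$ for $ab = cd$.
  Applied to the squares, it yields
  $j(q^3)^2 j(-q^4)^2 - q^2 j(q)^2 j(-q^2)^2 = j(q^2)\,j(q^4)\,j(-q^5)^2$,
  which is the first identity; the second one comes from writing $j(\pm q^3)\,j(\mp q)$ as the sum and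
  the difference of the same two products of theta series in $q^{20}$.
\<close>

section \<open>Formal generating functions over weighted index sets\<close>

text \<open>When \<open>e\<close> has finite fibres, this is the formal sum of
  \<open>w i * X^(e i)\<close>. A sum over an infinite set is 0 by convention, hence the finiteness
  assumptions in the rules for products and disjoint unions.\<close>

definition weighted_gf :: "'i set \<Rightarrow> ('i \<Rightarrow> nat) \<Rightarrow> ('i \<Rightarrow> 'a::comm_ring_1) \<Rightarrow> 'a fps" where
  "weighted_gf S e w = Abs_fps (\<lambda>N. \<Sum>i | i \<in> S \<and> e i = N. w i)"

text \<open>The Cauchy product sorts the pairs by the exponent \<open>k\<close> of the left factor;
  the resulting blocks partition the fibre of the total exponent.\<close>

lemma weighted_gf_mult:
  assumes "\<And>N. finite {i \<in> S. e i = N}" "\<And>N. finite {j \<in> T. d j = N}"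
  shows "weighted_gf S e w * weighted_gf T d v =
    weighted_gf (S \<times> T) (\<lambda>(i, j). e i + d j) (\<lambda>(i, j). w i * v j)"
proof (rule fps_ext)
  fix N
  let ?F = "\<lambda>k. {i \<in> S. e i = k} \<times> {j \<in> T. d j = N - k}"
  have "fps_nth (weighted_gf S e w * weighted_gf T d v) N = (\<Sum>k=0..N. \<Sum>(i, j)\<in>?F k. w i * v j)"
    by (simp add: weighted_gf_def fps_mult_nth sum_product sum.cartesian_product)
  also have "\<dots> = (\<Sum>(i, j)\<in>(\<Union>k\<in>{0..N}. ?F k). w i * v j)"
    by (rule sum.UNION_disjoint[symmetric]) (use assms in auto)
  also have "(\<Union>k\<in>{0..N}. ?F k) = {p \<in> S \<times> T. (\<lambda>(i, j). e i + d j) p = N}"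
    by auto
  finally show "fps_nth (weighted_gf S e w * weighted_gf T d v) N =
      fps_nth (weighted_gf (S \<times> T) (\<lambda>(i, j). e i + d j) (\<lambda>(i, j). w i * v j)) N"
    by (simp add: weighted_gf_def)
qed

lemma weighted_gf_reindex:
  assumes "bij_betw h T S" "\<And>t. t \<in> T \<Longrightarrow> e (h t) = d t" "\<And>t. t \<in> T \<Longrightarrow> w (h t) = v t"
  shows "weighted_gf S e w = weighted_gf T d v"
proof -
  have "(\<Sum>i | i \<in> S \<and> e i = N. w i) = (\<Sum>t | t \<in> T \<and> d t = N. v t)" for N
  proof (rule sum.reindex_bij_betw[of h, symmetric, THEN trans[OF _ sum.cong]])
    show "bij_betw h {t \<in> T. d t = N} {i \<in> S. e i = N}"
      using assms(1,2) by (force simp: bij_betw_def inj_on_def image_iff)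
  qed (use assms in auto)
  then show ?thesis
    by (simp add: weighted_gf_def)
qed

lemma weighted_gf_Un:
  assumes "\<And>N. finite {i \<in> S \<union> T. e i = N}" "S \<inter> T = {}"
  shows "weighted_gf (S \<union> T) e w = weighted_gf S e w + weighted_gf T e w"
proof (rule fps_ext)
  fix N
  have "{i. i \<in> S \<union> T \<and> e i = N} = {i. i \<in> S \<and> e i = N} \<union> {i. i \<in> T \<and> e i = N}"
    by auto
  moreover have "finite {i. i \<in> S \<and> e i = N}" "finite {i. i \<in> T \<and> e i = N}"
    using assms(1)[of N] by (auto elim: rev_finite_subset)
  ultimately show "fps_nth (weighted_gf (S \<union> T) e w) N =
      fps_nth (weighted_gf S e w + weighted_gf T e w) N"
    using assms(2) by (simp add: weighted_gf_def) (subst sum.union_disjoint; auto)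
qed

lemma weighted_gf_shift:
  "weighted_gf S (\<lambda>i. c + e i) (\<lambda>i. a * w i) = fps_const a * fps_X ^ c * weighted_gf S e w"
proof (rule fps_ext)
  fix N
  have "(\<Sum>i | i \<in> S \<and> c + e i = N. w i) = (if N < c then 0 else \<Sum>i | i \<in> S \<and> e i = N - c. w i)"
    by (auto intro!: sum.cong)
  then show "fps_nth (weighted_gf S (\<lambda>i. c + e i) (\<lambda>i. a * w i)) N =
      fps_nth (fps_const a * fps_X ^ c * weighted_gf S e w) N"
    by (simp add: weighted_gf_def mult.assoc fps_X_power_mult_nth flip: sum_distrib_left)
qed

section \<open>Exponents of theta series\<close>

text \<open>The conversion by \<open>nat\<close> loses nothing when \<open>a \<le> m\<close> and
  \<open>0 < m\<close>, since the integer is then nonnegative.\<close>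

definition theta_exp :: "nat \<Rightarrow> nat \<Rightarrow> int \<Rightarrow> nat" where
  "theta_exp a m n = nat (int m * (n * (n - 1) div 2) + int a * n)"

text \<open>For \<open>w = \<plusminus>1\<close>, \<open>theta w a m\<close> is Ramanujan's $f(wq^a, wq^{m-a})$; the exponent
  $|n|$ stands for $n$, since $w^{-1} = w$.\<close>
definition theta :: "'a::comm_ring_1 \<Rightarrow> nat \<Rightarrow> nat \<Rightarrow> 'a fps" where
  "theta w a m = weighted_gf UNIV (theta_exp a m) (\<lambda>n. w ^ nat \<bar>n\<bar>)"

lemma triangle_int: "2 * (n * (n - 1) div 2) = n * (n - 1)" for n :: int
  by (rule dvd_mult_div_cancel) simp

lemma triangle_int_nonneg: "0 \<le> n * (n - 1) div 2" for n :: int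
  by (cases "n \<le> 0") (auto simp: mult_nonpos_nonpos pos_imp_zdiv_nonneg_iff)

text \<open>A linear lower bound for a quadratic exponent. It makes the fibres of
  \<open>theta_exp\<close> finite and controls the truncation error in the triple product. The case
  \<open>a = 0\<close> is included because squaring a theta series produces it.\<close>

lemma abs_le_theta_exp:
  assumes "a \<le> m" "0 < m"
  shows "0 \<le> int m * (n * (n - 1) div 2) + int a * n"
    and "\<bar>n\<bar> \<le> int m * (n * (n - 1) div 2) + int a * n + 1"
proof -
  define t where "t = n * (n - 1) div 2"
  have t2: "2 * t = n * (n - 1)" unfolding t_def by (rule triangle_int)
  have t0: "0 \<le> t" unfolding t_def by (rule triangle_int_nonneg)
  have "\<bar>n\<bar> \<le> int m * t + int a * n + 1"
  proof (cases "n \<ge> 0")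
    case True
    \<comment> \<open>Doubled, \<open>n \<le> t + 1\<close> says exactly this. For negative
      \<open>n\<close> the analogue uses \<open>t + n\<close>, which is n(n+1)/2, and
      \<open>a * n \<ge> m * n\<close>.\<close>
    have "0 \<le> (n - 1) * (n - 2)"
      by (cases "n \<le> 1") (auto intro: mult_nonpos_nonpos)
    then have "n \<le> t + 1" using t2 by (simp add: algebra_simps)
    moreover have "1 * t \<le> int m * t" using assms t0
      by (intro mult_right_mono) auto
    moreover have "0 \<le> int a * n" using True by simp
    ultimately show ?thesis using True by linarith
  next
    case False
    have "0 \<le> (n + 1) * (n + 2)"
      by (cases "n = - 1") (use False in \<open>auto intro: mult_nonpos_nonpos\<close>)
    then have 1: "- n \<le> t + n + 1" using t2 by (simp add: algebra_simps)
    then have "t + n \<ge> 0" using False by simp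
    then have "1 * (t + n) \<le> int m * (t + n)" using assms by (intro mult_right_mono) auto
    moreover have "int m * n \<le> int a * n" using False assms by (intro mult_right_mono_neg) auto
    ultimately have "t + n \<le> int m * t + int a * n"
      by (simp add: distrib_left del: mult_le_cancel_right mult_le_cancel_left)
    then show ?thesis using 1 False by linarith
  qed
  moreover have "0 \<le> int m * t + int a * n" if "n = 0" using t0 that by simp
  ultimately show "0 \<le> int m * (n * (n - 1) div 2) + int a * n"
     "\<bar>n\<bar> \<le> int m * (n * (n - 1) div 2) + int a * n + 1"
    unfolding t_def by fastforce+
qed

text \<open>Doubling removes both \<open>div\<close> and \<open>nat\<close>, so that identities
  between exponents become polynomial identities over the integers.\<close>

lemma int_theta_exp:
  assumes "a \<le> m" "0 < m"
  shows "2 * int (theta_exp a m n) = int m * (n * (n - 1)) + 2 * int a * n"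
proof -
  have "int m * (n * (n - 1)) = 2 * (int m * (n * (n - 1) div 2))"
    using triangle_int[of n] by (metis mult.left_commute)
  then show ?thesis using abs_le_theta_exp(1)[OF assms, of n] by (simp add: theta_exp_def)
qed

lemma abs_le_theta_exp_nat:
  assumes "a \<le> m" "0 < m"
  shows "\<bar>n\<bar> \<le> int (theta_exp a m n) + 1"
  using abs_le_theta_exp[OF assms, of n] by (simp add: theta_exp_def)

lemma finite_theta_exp:
  assumes "a \<le> m" "0 < m"
  shows "finite {n \<in> S. theta_exp a m n = N}"
proof (rule finite_subset)
  show "{n \<in> S. theta_exp a m n = N} \<subseteq> {- int N - 1..int N + 1}"
  proof
    fix n assume "n \<in> {n \<in> S. theta_exp a m n = N}"
    then show "n \<in> {- int N - 1..int N + 1}"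
      using abs_le_theta_exp_nat[OF assms, of n] by auto
  qed
qed simp


section \<open>Rotation of the index lattice and products of theta series\<close>

lemma even_nat_abs: "even (nat \<bar>n\<bar>) = even (n :: int)"
  by (simp add: even_nat_iff)

lemma bij_betw_even_pairs: "bij_betw (\<lambda>(u, t). (u + t, u - t)) UNIV {(x, y). even (x + y :: int)}"
proof (rule bij_betw_imageI)
  show "(\<lambda>(u, t). (u + t, u - t)) ` UNIV = {(x, y). even (x + y :: int)}"
  proof safe
    fix x y :: int assume "even (x + y)"
    then obtain k where "x + y = 2 * k" by (elim evenE)
    then have "(x, y) = (\<lambda>(u, t). (u + t, u - t)) (k, x - k)" by simp
    then show "(x, y) \<in> range (\<lambda>(u, t). (u + t, u - t))" by blast
  qed simp
qed (auto simp: inj_on_def)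

text \<open>The origin goes to (1, 0), the index pair whose exponent is the prefactor
  \<open>a\<close> in the product formula; with these signs the two new theta parameters come out
  directly as \<open>m - a - c\<close> and \<open>c - a\<close>.\<close>

lemma bij_betw_odd_pairs: "bij_betw (\<lambda>(u, t). (1 - u - t, t - u)) UNIV {(x, y). odd (x + y :: int)}"
proof (rule bij_betw_imageI)
  show "(\<lambda>(u, t). (1 - u - t, t - u)) ` UNIV = {(x, y). odd (x + y :: int)}"
  proof safe
    fix x y :: int assume "odd (x + y)"
    then obtain k where "x + y = 2 * k + 1" by (elim oddE)
    then have "(x, y) = (\<lambda>(u, t). (1 - u - t, t - u)) (- k, y - k)" by simp
    then show "(x, y) \<in> range (\<lambda>(u, t). (1 - u - t, t - u))" by blast
  qed simp
qed (auto simp: inj_on_def)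

text \<open>Ramanujan's formula for f(a,b) f(c,d) with ab = cd. The common modulus \<open>m\<close>
  makes the quadratic form a multiple of x^2 + y^2, which the rotation by 45 degrees keeps
  diagonal.\<close>

lemma theta_mult:
  fixes w v :: "'a::comm_ring_1"
  assumes w: "w = 1 \<or> w = - 1" and v: "v = 1 \<or> v = - 1"
    and ac: "a \<le> c" "a + c \<le> m" and m: "0 < m"
  shows "theta w a m * theta v c m =
    theta (w * v) (a + c) (2 * m) * theta (w * v) (a + m - c) (2 * m) +
    fps_const w * fps_X ^ a * (theta (w * v) (m - a - c) (2 * m) * theta (w * v) (c - a) (2 * m))"
proof -
  define e where "e = (\<lambda>(x, y). theta_exp a m x + theta_exp c m y)"
  define g where "g = (\<lambda>(x :: int, y :: int). w ^ nat \<bar>x\<bar> * v ^ nat \<bar>y\<bar>)"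
  have am: "a \<le> m" "c \<le> m" "a + c \<le> 2 * m" "a + m - c \<le> 2 * m" "m - a - c \<le> 2 * m" "c - a \<le> 2 * m"
    "0 < 2 * m"
    using ac m by auto
  have sub: "int (a + m - c) = int a + int m - int c" "int (m - a - c) = int m - int a - int c"
    "int (c - a) = int c - int a"
    using ac by auto
  have e2: "2 * int (e (x, y)) = int m * (x * (x - 1) + y * (y - 1)) + 2 * int a * x + 2 * int c * y" for x y
    using int_theta_exp[OF am(1) m, of x] int_theta_exp[OF am(2) m, of y]
    by (simp add: e_def algebra_simps)
  let ?A = "{(x, y). even (x + y)} :: (int \<times> int) set"
  let ?B = "{(x, y). odd (x + y)} :: (int \<times> int) set"
  have AB: "UNIV = ?A \<union> ?B" "?A \<inter> ?B = {}" by auto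
  have fin: "finite {p. e p = N}" for N
  proof (rule finite_subset)
    show "{p. e p = N} \<subseteq> {- int N - 1..int N + 1} \<times> {- int N - 1..int N + 1}"
    proof
      fix p assume "p \<in> {p. e p = N}"
      then show "p \<in> {- int N - 1..int N + 1} \<times> {- int N - 1..int N + 1}"
        using abs_le_theta_exp_nat[OF am(1) m, of "fst p"] abs_le_theta_exp_nat[OF am(2) m, of "snd p"]
        by (cases p) (auto simp: e_def)
    qed
  qed simp
  have "theta w a m * theta v c m = weighted_gf (UNIV \<times> UNIV) e g"
    unfolding theta_def e_def g_def
    by (rule weighted_gf_mult) (intro finite_theta_exp am m)+
  also have "\<dots> = weighted_gf (?A \<union> ?B) e g"
    using AB(1) by simp
  also have "\<dots> = weighted_gf ?A e g + weighted_gf ?B e g"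
    using fin AB by (intro weighted_gf_Un) (auto elim: rev_finite_subset)
  also have "weighted_gf ?A e g =
      weighted_gf (UNIV \<times> UNIV) (\<lambda>(u, t). theta_exp (a + c) (2 * m) u + theta_exp (a + m - c) (2 * m) t)
        (\<lambda>(u, t). (w * v) ^ nat \<bar>u\<bar> * (w * v) ^ nat \<bar>t\<bar>)"
  proof (rule weighted_gf_reindex[OF bij_betw_even_pairs[folded UNIV_Times_UNIV]])
    fix p :: "int \<times> int"
    obtain u t where p: "p = (u, t)" by fastforce
    \<comment> \<open>The cross terms in u t cancel, so the exponent separates into a part in
      \<open>u\<close> and a part in \<open>t\<close>.\<close>
    have "2 * int (e (u + t, u - t)) =
        2 * int (theta_exp (a + c) (2 * m) u + theta_exp (a + m - c) (2 * m) t)"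
      using int_theta_exp[OF am(3,7), of u] int_theta_exp[OF am(4,7), of t]
      unfolding e2 of_nat_add distrib_left sub by (simp add: algebra_simps)
    then show "e (case p of (u, t) \<Rightarrow> (u + t, u - t)) =
        (case p of (u, t) \<Rightarrow> theta_exp (a + c) (2 * m) u + theta_exp (a + m - c) (2 * m) t)"
      by (simp add: p)
    \<comment> \<open>Signs depend on parity only, and both coordinates have the parity of u +
      t.\<close>
    show "g (case p of (u, t) \<Rightarrow> (u + t, u - t)) =
        (case p of (u, t) \<Rightarrow> (w * v) ^ nat \<bar>u\<bar> * (w * v) ^ nat \<bar>t\<bar>)"
      using w v by (auto simp: p g_def uminus_power_if even_nat_abs)
  qed
  also have "\<dots> = theta (w * v) (a + c) (2 * m) * theta (w * v) (a + m - c) (2 * m)"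
    unfolding theta_def by (rule weighted_gf_mult[symmetric]) (intro finite_theta_exp am)+
  also have "weighted_gf ?B e g =
      weighted_gf (UNIV \<times> UNIV) (\<lambda>p. a + (case p of (u, t) \<Rightarrow> theta_exp (m - a - c) (2 * m) u + theta_exp (c - a) (2 * m) t))
        (\<lambda>p. w * (case p of (u, t) \<Rightarrow> (w * v) ^ nat \<bar>u\<bar> * (w * v) ^ nat \<bar>t\<bar>))"
  proof (rule weighted_gf_reindex[OF bij_betw_odd_pairs[folded UNIV_Times_UNIV]])
    fix p :: "int \<times> int"
    obtain u t where p: "p = (u, t)" by fastforce
    have "2 * int (e (1 - u - t, t - u)) =
        2 * int (a + (theta_exp (m - a - c) (2 * m) u + theta_exp (c - a) (2 * m) t))"
      using int_theta_exp[OF am(5,7), of u] int_theta_exp[OF am(6,7), of t]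
      unfolding e2 of_nat_add distrib_left sub by (simp add: algebra_simps)
    then show "e (case p of (u, t) \<Rightarrow> (1 - u - t, t - u)) =
        a + (case p of (u, t) \<Rightarrow> theta_exp (m - a - c) (2 * m) u + theta_exp (c - a) (2 * m) t)"
      by (simp add: p)
    \<comment> \<open>The coordinates now have opposite parities, which leaves one extra factor
      \<open>w\<close>.\<close>
    show "g (case p of (u, t) \<Rightarrow> (1 - u - t, t - u)) =
        w * (case p of (u, t) \<Rightarrow> (w * v) ^ nat \<bar>u\<bar> * (w * v) ^ nat \<bar>t\<bar>)"
      using w v by (auto simp: p g_def uminus_power_if even_nat_abs)
  qed
  also have "\<dots> = fps_const w * fps_X ^ a * weighted_gf (UNIV \<times> UNIV)
      (\<lambda>(u, t). theta_exp (m - a - c) (2 * m) u + theta_exp (c - a) (2 * m) t)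
      (\<lambda>(u, t). (w * v) ^ nat \<bar>u\<bar> * (w * v) ^ nat \<bar>t\<bar>)"
    by (rule weighted_gf_shift)
  also have "weighted_gf (UNIV \<times> UNIV)
      (\<lambda>(u, t). theta_exp (m - a - c) (2 * m) u + theta_exp (c - a) (2 * m) t)
      (\<lambda>(u, t). (w * v) ^ nat \<bar>u\<bar> * (w * v) ^ nat \<bar>t\<bar>) =
      theta (w * v) (m - a - c) (2 * m) * theta (w * v) (c - a) (2 * m)"
    unfolding theta_def by (rule weighted_gf_mult[symmetric]) (intro finite_theta_exp am)+
  finally show ?thesis .
qed

section \<open>Gaussian binomials and the finite triple product\<close>

text \<open>The Gaussian binomial coefficient, given by its Pascal recurrence so that it makes sense
  in any commutative ring, without division.\<close>

fun qbinom :: "'a::comm_ring_1 \<Rightarrow> nat \<Rightarrow> nat \<Rightarrow> 'a" where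
  "qbinom p n 0 = 1"
| "qbinom p 0 (Suc j) = 0"
| "qbinom p (Suc n) (Suc j) = qbinom p n (Suc j) + p ^ (n - j) * qbinom p n j"

lemma qbinom_eq_0: "n < j \<Longrightarrow> qbinom p n j = 0"
  by (induction p n j rule: qbinom.induct) auto

lemma triangle_Suc: "Suc j * (Suc j - 1) div 2 = j + j * (j - 1) div 2"
proof -
  have "Suc j * (Suc j - 1) = 2 * j + j * (j - 1)"
    by (cases j) (auto simp: algebra_simps)
  then show ?thesis by simp
qed

text \<open>Induction on the last factor \<open>1 + x * p ^ n\<close>: Pascal's recurrence applies
  because (n - j) + j(j+1)/2 = n + j(j-1)/2.\<close>

lemma qbinom_theorem:
  "(\<Prod>k<n. 1 + x * p ^ k) = (\<Sum>j\<le>n. qbinom p n j * p ^ (j * (j - 1) div 2) * x ^ j)"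
proof (induction n)
  case (Suc n)
  define t where "t = (\<lambda>j. p ^ (j * (j - 1) div 2))"
  have *: "p ^ (n - j) * t (Suc j) = p ^ n * t j" if "j \<le> n" for j
    using that unfolding t_def by (simp only: triangle_Suc flip: power_add) simp
  have "(\<Sum>j\<le>Suc n. qbinom p (Suc n) j * t j * x ^ j) =
      1 + (\<Sum>j\<le>n. qbinom p (Suc n) (Suc j) * t (Suc j) * x ^ Suc j)"
    by (subst sum.atMost_Suc_shift) (simp add: t_def)
  also have "(\<Sum>j\<le>n. qbinom p (Suc n) (Suc j) * t (Suc j) * x ^ Suc j) =
      (\<Sum>j\<le>n. qbinom p n (Suc j) * t (Suc j) * x ^ Suc j + x * p ^ n * (qbinom p n j * t j * x ^ j))"
  proof (rule sum.cong[OF refl])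
    fix j assume "j \<in> {..n}"
    then have "p ^ (n - j) * t (Suc j) = p ^ n * t j" by (intro *) simp
    then have "p ^ (n - j) * (t (Suc j) * (x * x ^ j * qbinom p n j)) =
        p ^ n * (t j * (x * x ^ j * qbinom p n j))"
      by (simp only: flip: mult.assoc)
    then show "qbinom p (Suc n) (Suc j) * t (Suc j) * x ^ Suc j =
        qbinom p n (Suc j) * t (Suc j) * x ^ Suc j + x * p ^ n * (qbinom p n j * t j * x ^ j)"
      by (simp add: distrib_right distrib_left mult_ac)
  qed
  also have "1 + \<dots> = (1 + (\<Sum>j\<le>n. qbinom p n (Suc j) * t (Suc j) * x ^ Suc j)) +
      x * p ^ n * (\<Sum>j\<le>n. qbinom p n j * t j * x ^ j)"
    by (simp only: sum.distrib sum_distrib_left add.assoc)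
  also have "1 + (\<Sum>j\<le>n. qbinom p n (Suc j) * t (Suc j) * x ^ Suc j) =
      (\<Sum>j\<le>Suc n. qbinom p n j * t j * x ^ j)"
    by (subst sum.atMost_Suc_shift) (simp add: t_def)
  also have "\<dots> = (\<Sum>j\<le>n. qbinom p n j * t j * x ^ j)"
    by (simp add: qbinom_eq_0)
  finally have "(\<Sum>j\<le>Suc n. qbinom p (Suc n) j * t j * x ^ j) =
      (\<Sum>j\<le>n. qbinom p n j * t j * x ^ j) * (1 + x * p ^ n)"
    by (simp only: distrib_left distrib_right mult_1_left mult_1_right mult.commute)
  then show ?case
    using Suc.IH by (simp only: prod.lessThan_Suc t_def)
qed simp

text \<open>The quotient formula for Gaussian binomials with denominators cleared; it determines
  their limit in the triple product.\<close>

lemma qbinom_mult_fact: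
  assumes "j \<le> n"
  shows "qbinom p n j * ((\<Prod>k<j. 1 - p ^ Suc k) * (\<Prod>k<n - j. 1 - p ^ Suc k)) = (\<Prod>k<n. 1 - p ^ Suc k)"
  using assms
proof (induction p n j rule: qbinom.induct)
  case (3 p n j)
  define F where "F = (\<lambda>n. \<Prod>k<n. 1 - p ^ Suc k)"
  have FS: "F (Suc k) = F k * (1 - p ^ Suc k)" for k by (simp add: F_def)
  have j: "qbinom p n j * (F j * F (n - j)) = F n"
    using 3 by (simp add: F_def)
  show ?case
  proof (cases "j = n")
    case True
    then show ?thesis using j by (simp add: qbinom_eq_0 F_def mult.assoc[symmetric])
  next
    case False
    then have "Suc j \<le> n" using 3 by simp
    then have Sj: "qbinom p n (Suc j) * (F (Suc j) * F (n - Suc j)) = F n"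
      using 3 by (simp add: F_def)
    obtain d where n: "n = Suc (j + d)" using le_Suc_ex[OF \<open>Suc j \<le> n\<close>] by auto
    have nd: "n - j = Suc d" "n - Suc j = d" by (simp_all add: n)
    have "qbinom p (Suc n) (Suc j) * (F (Suc j) * F (Suc n - Suc j)) =
       (qbinom p n (Suc j) * (F (Suc j) * F d)) * (1 - p ^ Suc d) +
       p ^ Suc d * (1 - p ^ Suc j) * (qbinom p n j * (F j * F (Suc d)))"
      by (simp add: nd FS algebra_simps)
    \<comment> \<open>Since n + 1 = (d + 1) + (j + 1), the two coefficients of \<open>F n\<close>
      add up to 1 - p^(n+1).\<close>
    also have "\<dots> = F n * (1 - p ^ Suc n)"
      using j Sj by (simp add: nd algebra_simps) (simp add: n power_add algebra_simps)
    finally show ?thesis by (simp add: F_def)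
  qed
qed auto

text \<open>Needed for the embedding of power series into Laurent series, because the finite triple
  product divides by \<open>z\<close> and is proved over a field.\<close>

lemma qbinom_hom:
  assumes "f 0 = 0" "f 1 = 1" "\<And>x y. f (x + y) = f x + f y" "\<And>x y. f (x * y) = f x * f y"
  shows "f (qbinom p n j) = qbinom (f p) n j"
proof -
  have "f (p ^ k) = f p ^ k" for k by (induction k) (simp_all add: assms)
  then show ?thesis
    by (induction p n j rule: qbinom.induct) (simp_all add: assms)
qed

text \<open>This is the $q$-binomial theorem with $2n$ factors and $x = z p^{-n}$.\<close>
lemma finite_triple_product:
  fixes p z :: "'a::field"
  assumes p: "p \<noteq> 0" and z: "z \<noteq> 0"
  shows "(\<Prod>k<n. 1 + z * p ^ k) * (\<Prod>k<n. 1 + p ^ Suc k / z) =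
    (\<Sum>i\<in>{- int n..int n}. qbinom p (2 * n) (nat (i + int n)) *
       (p powi (i * (i - 1) div 2) * z powi i))"
proof -
  define x where "x = z / p ^ n"
  \<comment> \<open>\<open>c\<close> is the product of the factors z / p^(k+1), pulled out when the
    first n of the 2n factors are reversed and rewritten as 1 + p^(k+1) / z. The last n factors
    already have the form 1 + z p^k.\<close>
  define c where "c = z ^ n / p ^ (n * (n + 1) div 2)"
  have c0: "c \<noteq> 0" using p z by (simp add: c_def)
  have shift: "(\<Prod>k<n. 1 + x * p ^ k) = c * (\<Prod>k<n. 1 + p ^ Suc k / z)"
  proof -
    have "(\<Prod>k<n. 1 + x * p ^ k) = (\<Prod>k<n. 1 + x * p ^ (n - Suc k))"
      by (rule prod.nat_diff_reindex[symmetric])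
    also have "\<dots> = (\<Prod>k<n. (z / p ^ Suc k) * (1 + p ^ Suc k / z))"
    proof (rule prod.cong[OF refl])
      fix k assume "k \<in> {..<n}"
      then have "p ^ n = p ^ (n - Suc k) * p ^ Suc k" by (simp flip: power_add power_Suc)
      then show "1 + x * p ^ (n - Suc k) = (z / p ^ Suc k) * (1 + p ^ Suc k / z)"
        using p z by (simp add: x_def field_simps)
    qed
    also have "\<dots> = (\<Prod>k<n. z / p ^ Suc k) * (\<Prod>k<n. 1 + p ^ Suc k / z)"
      by (rule prod.distrib)
    also have "(\<Prod>k<n. z / p ^ Suc k) = c"
    proof -
      have "(\<Prod>k<n. z / p ^ Suc k) = z ^ n / p ^ (n * (n + 1) div 2)" for n
      proof (induction n)
        case (Suc n)
        have "Suc n * (Suc n + 1) div 2 = n * (n + 1) div 2 + Suc n" by simp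
        then show ?case using Suc by (simp only: prod.lessThan_Suc) (simp add: power_add mult_ac)
      qed simp
      then show ?thesis by (simp add: c_def)
    qed
    finally show ?thesis .
  qed
  have split: "(\<Prod>k<n + n'. g k) = (\<Prod>k<n. g k) * (\<Prod>k<n'. g (n + k))" for g :: "nat \<Rightarrow> 'a" and n'
    by (induction n') (simp_all add: mult_ac)
  have "c * ((\<Prod>k<n. 1 + z * p ^ k) * (\<Prod>k<n. 1 + p ^ Suc k / z)) = (\<Prod>k<n + n. 1 + x * p ^ k)"
  proof -
    have "x * p ^ (n + k) = z * p ^ k" for k using p by (simp add: x_def power_add)
    then show ?thesis unfolding split shift by (simp only: mult_ac)
  qed
  also have "\<dots> = (\<Sum>j\<le>2 * n. qbinom p (2 * n) j * p ^ (j * (j - 1) div 2) * x ^ j)"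
    by (simp only: qbinom_theorem mult_2)
  also have "\<dots> = (\<Sum>i\<in>{- int n..int n}. c * (qbinom p (2 * n) (nat (i + int n)) *
       (p powi (i * (i - 1) div 2) * z powi i)))"
  proof (rule sum.reindex_bij_witness[where i = "\<lambda>i. nat (i + int n)" and j = "\<lambda>j. int j - int n"])
    fix j assume "j \<in> {..2 * n}"
    define i where "i = int j - int n"
    have j: "int j = i + int n" by (simp add: i_def)
    have "2 * int (j * (j - 1) div 2) = int j * (int j - 1)"
    proof -
      have "2 * int (j * (j - 1) div 2) = int (2 * (j * (j - 1) div 2))"
        by (simp only: of_nat_mult of_nat_numeral)
      also have "2 * (j * (j - 1) div 2) = j * (j - 1)"
        by (rule dvd_mult_div_cancel) auto
      also have "int (j * (j - 1)) = int j * (int j - 1)"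
        by (cases j) (auto simp: algebra_simps)
      finally show ?thesis .
    qed
    moreover have "2 * int (n * (n + 1) div 2) = int n * (int n + 1)"
    proof -
      have "2 * int (n * (n + 1) div 2) = int (2 * (n * (n + 1) div 2))"
        by (simp only: of_nat_mult of_nat_numeral)
      also have "2 * (n * (n + 1) div 2) = n * (n + 1)"
        by (rule dvd_mult_div_cancel) auto
      finally show ?thesis by (simp add: algebra_simps)
    qed
    \<comment> \<open>Doubled, this is j(j-1) - 2nj + n(n+1) = (j-n)(j-n-1).\<close>
    ultimately have "int (j * (j - 1) div 2) - int n * int j + int (n * (n + 1) div 2) = i * (i - 1) div 2"
      using triangle_int[of i] by (simp add: j algebra_simps)
    then have e: "int (j * (j - 1) div 2) - int n * int j = i * (i - 1) div 2 - int (n * (n + 1) div 2)"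
      by simp
    have "p ^ (j * (j - 1) div 2) * x ^ j = p powi (int (j * (j - 1) div 2) - int n * int j) * z powi int j"
      using p by (simp add: x_def power_int_diff power_divide power_int_mult flip: power_mult)
    also have "\<dots> = c * (p powi (i * (i - 1) div 2) * z powi i)"
      unfolding e unfolding j using p z by (simp add: c_def power_int_diff power_int_add)
    finally show "c * (qbinom p (2 * n) (nat ((int j - int n) + int n)) *
         (p powi ((int j - int n) * ((int j - int n) - 1) div 2) * z powi (int j - int n))) =
       qbinom p (2 * n) j * p ^ (j * (j - 1) div 2) * x ^ j"
      by (simp add: i_def mult_ac)
  qed auto
  finally show ?thesis using c0 by (simp flip: sum_distrib_left)
qed

section \<open>Congruence of power series modulo powers of X\<close>

text \<open>Congruence modulo X^n. Series congruent for every \<open>n\<close> are equal, so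
  identities between infinite products can be checked on finite truncations.\<close>

definition fps_cong :: "nat \<Rightarrow> 'a::comm_ring_1 fps \<Rightarrow> 'a fps \<Rightarrow> bool" where
  "fps_cong n f g \<longleftrightarrow> (\<forall>k<n. fps_nth f k = fps_nth g k)"

lemma fps_cong_refl: "fps_cong n f f"
  by (simp add: fps_cong_def)

lemma fps_cong_sym: "fps_cong n f g \<Longrightarrow> fps_cong n g f"
  by (simp add: fps_cong_def)

lemma fps_cong_trans [trans]: "fps_cong n f g \<Longrightarrow> fps_cong n g h \<Longrightarrow> fps_cong n f h"
  by (simp add: fps_cong_def)

lemma fps_cong_trans_left: "fps_cong n f g \<Longrightarrow> fps_cong n f h \<Longrightarrow> fps_cong n g h"
  by (simp add: fps_cong_def)

lemma fps_cong_mono: "fps_cong n f g \<Longrightarrow> m \<le> n \<Longrightarrow> fps_cong m f g"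
  by (simp add: fps_cong_def)

lemma fps_cong_mult: "fps_cong n f g \<Longrightarrow> fps_cong n f' g' \<Longrightarrow> fps_cong n (f * f') (g * g')"
  by (auto simp: fps_cong_def fps_mult_nth intro!: sum.cong)

lemma fps_cong_sum: "(\<And>i. i \<in> A \<Longrightarrow> fps_cong n (f i) (g i)) \<Longrightarrow> fps_cong n (sum f A) (sum g A)"
  by (auto simp: fps_cong_def fps_sum_nth intro!: sum.cong)

lemma fps_cong_prod: "(\<And>i. i \<in> A \<Longrightarrow> fps_cong n (f i) (g i)) \<Longrightarrow> fps_cong n (prod f A) (prod g A)"
  by (induction A rule: infinite_finite_induct) (auto intro: fps_cong_refl fps_cong_mult)

text \<open>Multiplication by X^e gains \<open>e\<close> digits of precision; in the triple product
  this compensates for the poor precision of the outer binomials.\<close>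

lemma fps_cong_X_power_mult: "fps_cong n f g \<Longrightarrow> fps_cong (n + e) (fps_X ^ e * f) (fps_X ^ e * g)"
  by (auto simp: fps_cong_def fps_X_power_mult_nth)

lemma fps_eqI_cong: "(\<And>n. fps_cong n f g) \<Longrightarrow> f = g"
  by (auto simp: fps_cong_def fps_eq_iff)

section \<open>Infinite products as power series\<close>

definition qpoch_fin :: "'a::comm_ring_1 \<Rightarrow> nat \<Rightarrow> nat \<Rightarrow> nat \<Rightarrow> 'a fps" where
  "qpoch_fin s a m n = (\<Prod>k<n. 1 - fps_const s * fps_X ^ (a + m * k))"

text \<open>\<open>qpoch s a m\<close> is $(sq^a; q^m)_\infty$ (for \<open>m > 0\<close>); the coefficient of $q^N$ only depends
  on the first \<open>N + 1\<close> factors.\<close>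
definition qpoch :: "'a::comm_ring_1 \<Rightarrow> nat \<Rightarrow> nat \<Rightarrow> 'a fps" where
  "qpoch s a m = Abs_fps (\<lambda>N. fps_nth (qpoch_fin s a m (Suc N)) N)"

text \<open>Each factor with index k \<ge> n is 1 modulo X^n, its exponent being at least k.\<close>

lemma fps_cong_qpoch_fin:
  assumes "0 < m" "n \<le> n'"
  shows "fps_cong n (qpoch_fin s a m n') (qpoch_fin s a m n)"
  using assms(2)
proof (induction n' rule: dec_induct)
  case (step k)
  have "1 * k \<le> m * k" using assms(1) by (intro mult_le_mono1) auto
  then have "n \<le> a + m * k" using step.hyps by linarith
  then have "fps_cong n (1 - fps_const s * fps_X ^ (a + m * k)) 1"
    by (auto simp: fps_cong_def)
  from fps_cong_mult[OF step.IH this] show ?case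
    by (simp add: qpoch_fin_def)
qed (rule fps_cong_refl)

lemma fps_cong_qpoch:
  assumes "0 < m" "n \<le> n'"
  shows "fps_cong n (qpoch_fin s a m n') (qpoch s a m)"
  unfolding fps_cong_def
proof (intro allI impI)
  fix k assume "k < n"
  then have "fps_cong (Suc k) (qpoch_fin s a m n') (qpoch_fin s a m (Suc k))"
    using assms by (intro fps_cong_qpoch_fin) auto
  then show "fps_nth (qpoch_fin s a m n') k = fps_nth (qpoch s a m) k"
    by (simp add: fps_cong_def qpoch_def)
qed

lemma qpoch_nth_0: "0 < a \<Longrightarrow> fps_nth (qpoch s a m) 0 = 1"
  by (simp add: qpoch_def qpoch_fin_def)

lemma one_minus_times_one_plus:
  "(1 - fps_const 1 * y) * (1 - fps_const (- 1) * y) = (1 - fps_const 1 * (y * y) :: 'a::comm_ring_1 fps)"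
proof -
  have "fps_const (- 1) = (- 1 :: 'a fps)"
    by (metis fps_const_1_eq_1 fps_const_neg)
  show ?thesis unfolding \<open>fps_const (- 1) = _\<close> by (simp add: algebra_simps)
qed

text \<open>Factor by factor this is (1 - y)(1 + y) = 1 - y^2. It later reduces products to base
  q^20 with even exponents to base q^10.\<close>

lemma qpoch_mult_neg:
  assumes "0 < m"
  shows "qpoch 1 a m * qpoch (- 1) a m = (qpoch 1 (2 * a) (2 * m) :: 'a::comm_ring_1 fps)"
proof (rule fps_eqI_cong)
  fix n
  have eq: "qpoch_fin 1 a m n * qpoch_fin (- 1) a m n = (qpoch_fin 1 (2 * a) (2 * m) n :: 'a fps)"
    unfolding qpoch_fin_def prod.distrib[symmetric]
  proof (rule prod.cong[OF refl])
    fix k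
    have *: "2 * a + 2 * m * k = (a + m * k) + (a + m * k)" by simp
    show "(1 - fps_const 1 * fps_X ^ (a + m * k)) * (1 - fps_const (- 1) * fps_X ^ (a + m * k)) =
        (1 - fps_const 1 * fps_X ^ (2 * a + 2 * m * k) :: 'a fps)"
      unfolding * by (subst power_add) (rule one_minus_times_one_plus)
  qed
  have c1: "fps_cong n (qpoch_fin 1 a m n * qpoch_fin (- 1) a m n)
      (qpoch 1 a m * qpoch (- 1) a m :: 'a fps)"
    using assms by (intro fps_cong_mult fps_cong_qpoch) auto
  have c2: "fps_cong n (qpoch_fin 1 (2 * a) (2 * m) n) (qpoch 1 (2 * a) (2 * m) :: 'a fps)"
    using assms by (intro fps_cong_qpoch) auto
  show "fps_cong n (qpoch 1 a m * qpoch (- 1) a m) (qpoch 1 (2 * a) (2 * m) :: 'a fps)"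
    by (rule fps_cong_trans_left[OF c1[unfolded eq] c2])
qed

lemma prod_lessThan_mult: "(\<Prod>k<n * d. g k) = (\<Prod>j<d. \<Prod>k<n. g (d * k + j))"
  for g :: "nat \<Rightarrow> 'a::comm_monoid_mult"
proof (induction n)
  case (Suc n)
  have "(\<Prod>k<n * d + d'. g k) = (\<Prod>k<n * d. g k) * (\<Prod>j<d'. g (d * n + j))" for d'
    by (induction d') (simp_all add: mult_ac)
  then show ?case
    using Suc by (simp add: prod.distrib add.commute[of d])
qed simp

text \<open>The factors are sorted by their index modulo \<open>d\<close>; truncating at
  \<open>n * d\<close> on the left leaves exactly \<open>n\<close> factors in each class.\<close>

lemma qpoch_dissect:
  assumes "0 < m" "0 < d"
  shows "qpoch s a m = (\<Prod>j<d. qpoch s (a + m * j) (m * d))"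
proof (rule fps_eqI_cong)
  fix n
  have c1: "fps_cong n (qpoch_fin s a m (n * d)) (qpoch s a m)"
    using assms by (intro fps_cong_qpoch) auto
  have eq: "qpoch_fin s a m (n * d) = (\<Prod>j<d. qpoch_fin s (a + m * j) (m * d) n)"
    unfolding qpoch_fin_def prod_lessThan_mult[of _ n d] by (simp add: algebra_simps)
  have c2: "fps_cong n (\<Prod>j<d. qpoch_fin s (a + m * j) (m * d) n) (\<Prod>j<d. qpoch s (a + m * j) (m * d))"
    using assms by (intro fps_cong_prod fps_cong_qpoch) auto
  show "fps_cong n (qpoch s a m) (\<Prod>j<d. qpoch s (a + m * j) (m * d))"
    by (rule fps_cong_trans_left[OF c1[unfolded eq] c2])
qed

text \<open>Links the analytic product to the coefficientwise one: every coefficient of the partial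
  products is eventually constant.\<close>

lemma qpoch_inf_eq_qpoch:
  assumes "0 < a" "0 < m"
  shows "qpoch_inf (fls_X ^ a) (fls_X ^ m) = fps_to_fls (qpoch 1 a m)"
proof -
  have "(\<lambda>n. \<Prod>k\<le>n. 1 - fps_X ^ (a + m * k)) \<longlonglongrightarrow> (qpoch 1 a m :: complex fps)"
    unfolding tendsto_fps_iff
  proof
    fix N
    show "\<forall>\<^sub>F n in sequentially. fps_nth (\<Prod>k\<le>n. 1 - fps_X ^ (a + m * k)) N = fps_nth (qpoch 1 a m :: complex fps) N"
      using eventually_ge_at_top[of N]
    proof eventually_elim
      case (elim n)
      then show ?case
        using fps_cong_qpoch[of m "Suc N" "Suc n" "1 :: complex" a] assms
        by (simp add: fps_cong_def qpoch_fin_def lessThan_Suc_atMost)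
    qed
  qed
  then have "(\<lambda>n. fps_to_fls (\<Prod>k\<le>n. 1 - fps_X ^ (a + m * k))) \<longlonglongrightarrow> fps_to_fls (qpoch 1 a m :: complex fps)"
    unfolding tendsto_iff by (simp only: dist_fps_to_fls)
  then have "(\<lambda>n. \<Prod>k\<le>n. fps_to_fls (1 - fps_X ^ (a + m * k))) \<longlonglongrightarrow> fps_to_fls (qpoch 1 a m :: complex fps)"
    by (simp only: fps_to_fls_prod)
  moreover have "fps_to_fls (1 - fps_X ^ (a + m * k)) = (1 - fls_X ^ a * (fls_X ^ m) ^ k :: complex fls)" for k
    by (simp add: fps_to_fls_power flip: power_mult power_add)
  ultimately have lim: "(\<lambda>n. \<Prod>k\<le>n. 1 - fls_X ^ a * (fls_X ^ m) ^ k) \<longlonglongrightarrow> fps_to_fls (qpoch 1 a m :: complex fps)"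
    by (simp only:)
  \<comment> \<open>Convergence in the sense of \<open>has_prod\<close> includes a nonzero limit;
    here the constant coefficient is 1.\<close>
  have "fps_to_fls (qpoch 1 a m) \<noteq> (0 :: complex fls)"
    using qpoch_nth_0[OF assms(1), of "1 :: complex" m] by auto
  with lim have "raw_has_prod (\<lambda>k. 1 - fls_X ^ a * (fls_X ^ m) ^ k) 0 (fps_to_fls (qpoch 1 a m :: complex fps))"
    by (simp only: raw_has_prod_def add_0_right) blast
  then have "(\<lambda>k. 1 - fls_X ^ a * (fls_X ^ m) ^ k) has_prod fps_to_fls (qpoch 1 a m :: complex fps)"
    unfolding has_prod_def by blast
  from has_prod_unique[OF this] show ?thesis
    by (simp only: qpoch_inf_def)
qed

section \<open>The Jacobi triple product\<close>

lemma fps_to_fls_prod_ring: "fps_to_fls (prod f A) = (\<Prod>k\<in>A. fps_to_fls (f k :: 'a::comm_ring_1 fps))"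
  by (induction A rule: infinite_finite_induct) (auto simp: fls_times_fps_to_fls)

lemma fps_to_fls_sum: "fps_to_fls (sum f A) = (\<Sum>k\<in>A. fps_to_fls (f k :: 'a::comm_ring_1 fps))"
  by (induction A rule: infinite_finite_induct) auto

lemma sign_power_int:
  fixes w :: "'a::field"
  assumes "w = 1 \<or> w = - 1"
  shows "w powi i = w ^ nat \<bar>i\<bar>"
  using assms by (cases "i \<ge> 0") (auto simp: power_int_def)

lemma power_int_combine:
  fixes x c :: "'a::field"
  assumes "x \<noteq> 0"
  shows "(x ^ m) powi t * (c * x ^ a) powi i = c powi i * x powi (int m * t + int a * i)"
proof -
  have *: "(x ^ m) powi t = x powi (int m * t)" for m t
    by (simp add: power_int_mult)
  show ?thesis
    unfolding power_int_mult_distrib *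
    using assms by (subst power_int_add) (simp_all add: mult_ac)
qed

text \<open>The finite identity at p = X^m and z = w X^a, taken in Laurent series, where z is
  invertible; both sides lie in the image of the power series.\<close>

lemma finite_triple_product_fps:
  fixes w :: "'a::field"
  assumes w: "w = 1 \<or> w = - 1" and a: "0 < a" "a < m"
  shows "qpoch_fin (- w) a m n * qpoch_fin (- w) (m - a) m n =
    (\<Sum>i\<in>{- int n..int n}. qbinom (fps_X ^ m) (2 * n) (nat (i + int n)) *
      (fps_const (w ^ nat \<bar>i\<bar>) * fps_X ^ theta_exp a m i))"
proof -
  define p z :: "'a fls" where "p = fls_X ^ m" and "z = fls_const w * fls_X ^ a"
  have w0: "w \<noteq> 0" "w * w = 1" using w by auto
  have nz: "p \<noteq> 0" "z \<noteq> 0" using w0 by (simp_all add: p_def z_def)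
  have neg: "fls_const (- w) = - fls_const w"
    by (rule fls_eqI) simp
  have "fps_to_fls (1 - fps_const (- w) * fps_X ^ (a + m * k)) = 1 + z * p ^ k" for k
    by (simp add: z_def p_def fls_times_fps_to_fls fps_to_fls_power power_add power_mult mult.assoc neg)
  moreover have "fps_to_fls (1 - fps_const (- w) * fps_X ^ (m - a + m * k)) = 1 + p ^ Suc k / z" for k
  proof -
    have "fls_X ^ (m - a + m * k) * fls_X ^ a = (p ^ Suc k :: 'a fls)"
      using a by (simp add: p_def flip: power_add power_mult)
    \<comment> \<open>As \<open>w\<close> is its own inverse, dividing p^(k+1) by z gives the factor
      \<open>w\<close> again.\<close>
    moreover have "fls_const w * fls_const w = 1"
      using w0 by simp
    ultimately have "fls_const w * fls_X ^ (m - a + m * k) * z = p ^ Suc k"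
      unfolding z_def by (metis (no_types, lifting) mult.assoc mult.commute mult_1)
    then have "fls_const w * fls_X ^ (m - a + m * k) = p ^ Suc k / z"
      using nz by (simp add: field_simps)
    then show ?thesis
      by (simp add: fls_times_fps_to_fls fps_to_fls_power neg)
  qed
  ultimately have "fps_to_fls (qpoch_fin (- w) a m n * qpoch_fin (- w) (m - a) m n) =
      (\<Prod>k<n. 1 + z * p ^ k) * (\<Prod>k<n. 1 + p ^ Suc k / z)"
    by (simp only: qpoch_fin_def fls_times_fps_to_fls fps_to_fls_prod_ring)
  also have "\<dots> = (\<Sum>i\<in>{- int n..int n}. qbinom p (2 * n) (nat (i + int n)) *
       (p powi (i * (i - 1) div 2) * z powi i))"
    by (rule finite_triple_product[OF nz])
  also have "\<dots> = fps_to_fls (\<Sum>i\<in>{- int n..int n}. qbinom (fps_X ^ m) (2 * n) (nat (i + int n)) *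
      (fps_const (w ^ nat \<bar>i\<bar>) * fps_X ^ theta_exp a m i))"
    unfolding fps_to_fls_sum
  proof (rule sum.cong[OF refl])
    fix i
    have "p powi (i * (i - 1) div 2) * z powi i =
        fls_const w powi i * fls_X powi (int m * (i * (i - 1) div 2) + int a * i)"
      unfolding p_def z_def by (rule power_int_combine) simp
    also have "int m * (i * (i - 1) div 2) + int a * i = int (theta_exp a m i)"
      using abs_le_theta_exp(1)[of a m i] a by (simp add: theta_exp_def)
    also have "fls_const w powi i = fls_const w ^ nat \<bar>i\<bar>"
      using w by (intro sign_power_int) auto
    finally have 1: "p powi (i * (i - 1) div 2) * z powi i =
        fps_to_fls (fps_const (w ^ nat \<bar>i\<bar>) * fps_X ^ theta_exp a m i)"
      by (simp add: fls_times_fps_to_fls fps_to_fls_power fls_const_power)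
    have "p = fps_to_fls (fps_X ^ m)" by (simp add: p_def fps_to_fls_power)
    then have 2: "qbinom p N j = fps_to_fls (qbinom (fps_X ^ m) N j)" for N j
      by (simp add: qbinom_hom[of fps_to_fls] fls_times_fps_to_fls)
    show "qbinom p (2 * n) (nat (i + int n)) * (p powi (i * (i - 1) div 2) * z powi i) =
      fps_to_fls (qbinom (fps_X ^ m) (2 * n) (nat (i + int n)) *
        (fps_const (w ^ nat \<bar>i\<bar>) * fps_X ^ theta_exp a m i))"
      unfolding 1 2 by (simp only: fls_times_fps_to_fls)
  qed
  finally show ?thesis by (simp only: fps_to_fls_eq_iff)
qed

text \<open>Since \<open>j\<close>, \<open>n - j\<close> and \<open>n\<close> are all at least
  \<open>k\<close>, the three q-factorials in \<open>qbinom_mult_fact\<close> agree with the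
  infinite product \<open>P\<close> modulo X^k. One copy of \<open>P\<close>, a unit, then
  cancels.\<close>

lemma fps_cong_qbinom:
  assumes m: "0 < m" and jn: "k \<le> j" "j + k \<le> n"
  shows "fps_cong k (qbinom (fps_X ^ m) n j * qpoch 1 m m) (1 :: 'a::field fps)"
proof -
  define P :: "'a fps" where "P = qpoch 1 m m"
  have P0: "fps_nth P 0 = 1" using m by (simp add: P_def qpoch_nth_0)
  have fact: "(\<Prod>k<n. 1 - (fps_X ^ m) ^ Suc k) = (qpoch_fin 1 m m n :: 'a fps)" for n
    by (simp add: qpoch_fin_def flip: power_mult power_add)
  have c: "fps_cong k (qpoch_fin 1 m m l) P" if "k \<le> l" for l
    unfolding P_def using m that by (rule fps_cong_qpoch)
  have "fps_cong k (qbinom (fps_X ^ m) n j * (P * P))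
      (qbinom (fps_X ^ m) n j * (qpoch_fin 1 m m j * qpoch_fin 1 m m (n - j)))"
    using jn by (intro fps_cong_mult fps_cong_refl c[THEN fps_cong_sym]) auto
  also have "\<dots> = qpoch_fin 1 m m n"
    using qbinom_mult_fact[of j n "fps_X ^ m :: 'a fps"] jn by (simp add: fact del: power_Suc)
  also have "fps_cong k \<dots> P"
    using jn by (intro c) auto
  finally have "fps_cong k (qbinom (fps_X ^ m) n j * (P * P) * inverse P) (P * inverse P)"
    by (rule fps_cong_mult[OF _ fps_cong_refl])
  moreover have "P * inverse P = 1" using P0 by (intro inverse_mult_eq_1') simp
  ultimately show ?thesis
    by (simp only: mult.assoc mult_1_right flip: P_def)
qed

text \<open>The limit of the finite version: each binomial times \<open>qpoch 1 m m\<close> tends to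
  1, leaving the theta series.\<close>

lemma jacobi_triple_product:
  fixes w :: "'a::field"
  assumes w: "w = 1 \<or> w = - 1" and a: "0 < a" "a < m"
  shows "qpoch (- w) a m * qpoch (- w) (m - a) m * qpoch 1 m m = theta w a m"
proof (rule fps_eqI_cong)
  fix n
  have m: "0 < m" "a \<le> m" using a by auto
  \<comment> \<open>The binomial in term i is known modulo X^(N - |i|) only, but its exponent is at
    least |i| - 1. The total precision is N - 1, hence the successor.\<close>
  define N where "N = Suc n"
  define f where "f = (\<lambda>i. fps_const (w ^ nat \<bar>i\<bar>) * fps_X ^ theta_exp a m i)"
  have "fps_cong n (qpoch (- w) a m * qpoch (- w) (m - a) m * qpoch 1 m m)
     (qpoch_fin (- w) a m N * qpoch_fin (- w) (m - a) m N * qpoch 1 m m)"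
    using m by (intro fps_cong_mult fps_cong_refl fps_cong_sym[OF fps_cong_qpoch]) (auto simp: N_def)
  also have "\<dots> = (\<Sum>i\<in>{- int N..int N}. f i * (qbinom (fps_X ^ m) (2 * N) (nat (i + int N)) * qpoch 1 m m))"
    unfolding finite_triple_product_fps[OF w a] sum_distrib_right f_def
    by (simp only: mult_ac)
  also have "fps_cong n \<dots> (\<Sum>i\<in>{- int N..int N}. f i * 1)"
  proof (rule fps_cong_sum)
    fix i assume i: "i \<in> {- int N..int N}"
    define k where "k = nat (int N - \<bar>i\<bar>)"
    have "fps_cong k (qbinom (fps_X ^ m) (2 * N) (nat (i + int N)) * qpoch 1 m m) (1 :: 'a fps)"
      using i m by (intro fps_cong_qbinom) (auto simp: k_def)
    then have "fps_cong (k + theta_exp a m i)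
        (fps_X ^ theta_exp a m i * (qbinom (fps_X ^ m) (2 * N) (nat (i + int N)) * qpoch 1 m m))
        (fps_X ^ theta_exp a m i * (1 :: 'a fps))"
      by (rule fps_cong_X_power_mult)
    moreover have "n \<le> k + theta_exp a m i"
      using abs_le_theta_exp_nat[OF m(2,1), of i] i by (simp add: k_def N_def)
    ultimately have "fps_cong n
        (fps_X ^ theta_exp a m i * (qbinom (fps_X ^ m) (2 * N) (nat (i + int N)) * qpoch 1 m m))
        (fps_X ^ theta_exp a m i * (1 :: 'a fps))"
      by (rule fps_cong_mono)
    from fps_cong_mult[OF fps_cong_refl this]
    show "fps_cong n (f i * (qbinom (fps_X ^ m) (2 * N) (nat (i + int N)) * qpoch 1 m m)) (f i * 1)"
      unfolding f_def mult.assoc .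
  qed
  \<comment> \<open>An exponent below n forces |i| \<le> n, so the truncated sum contains every
    relevant term.\<close>
  also have "fps_cong n \<dots> (theta w a m)"
    unfolding fps_cong_def
  proof (intro allI impI)
    fix k assume "k < n"
    have "{i. theta_exp a m i = k} \<subseteq> {- int N..int N}"
    proof
      fix i assume "i \<in> {i. theta_exp a m i = k}"
      then show "i \<in> {- int N..int N}"
        using abs_le_theta_exp_nat[OF m(2,1), of i] \<open>k < n\<close> by (simp add: N_def abs_le_iff)
    qed
    then have eq: "{i \<in> {- int N..int N}. theta_exp a m i = k} = {i \<in> UNIV. theta_exp a m i = k}" by auto
    have "fps_nth (\<Sum>i\<in>{- int N..int N}. f i * 1) k =
        (\<Sum>i\<in>{- int N..int N}. if theta_exp a m i = k then w ^ nat \<bar>i\<bar> else 0)"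
      by (auto simp: fps_sum_nth f_def intro!: sum.cong)
    also have "\<dots> = (\<Sum>i\<in>{i \<in> {- int N..int N}. theta_exp a m i = k}. w ^ nat \<bar>i\<bar>)"
      by (rule sum.inter_filter[symmetric]) simp
    also have "\<dots> = fps_nth (theta w a m) k"
      unfolding eq by (simp add: theta_def weighted_gf_def)
    finally show "fps_nth (\<Sum>i\<in>{- int N..int N}. f i * 1) k = fps_nth (theta w a m) k" .
  qed
  finally show "fps_cong n (qpoch (- w) a m * qpoch (- w) (m - a) m * qpoch 1 m m) (theta w a m)" .
qed

section \<open>Two relations between theta series\<close>

text \<open>All squares expand in the same two series f = \<open>theta 1 10 20\<close> and g =
  \<open>theta 1 0 20\<close>. The mixed terms f g cancel and the rest factors, one factor being the
  square of \<open>theta 1 5 10\<close>.\<close>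

lemma theta_relation_mu:
  "theta (- 1) 3 10 ^ 2 * theta 1 4 10 ^ 2 - fps_X ^ 2 * (theta (- 1) 1 10 ^ 2 * theta 1 2 10 ^ 2) =
    (theta (- 1) 2 10 * theta (- 1) 4 10 * theta 1 5 10 ^ 2 :: 'a::idom fps)"
proof -
  have "theta (- 1) 3 10 ^ 2 = theta 1 6 20 * theta 1 10 20 - fps_X ^ 3 * theta 1 4 20 * (theta 1 0 20 :: 'a fps)"
    using theta_mult[of "- 1 :: 'a" "- 1" 3 3 10] by (simp add: power2_eq_square mult.assoc flip: fps_const_neg)
  moreover have "theta 1 4 10 ^ 2 = theta 1 8 20 * theta 1 10 20 + fps_X ^ 4 * theta 1 2 20 * (theta 1 0 20 :: 'a fps)"
    using theta_mult[of "1 :: 'a" 1 4 4 10] by (simp add: power2_eq_square mult.assoc)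
  moreover have "theta (- 1) 1 10 ^ 2 = theta 1 2 20 * theta 1 10 20 - fps_X * theta 1 8 20 * (theta 1 0 20 :: 'a fps)"
    using theta_mult[of "- 1 :: 'a" "- 1" 1 1 10] by (simp add: power2_eq_square mult.assoc flip: fps_const_neg numeral_2_eq_2)
  moreover have "theta 1 2 10 ^ 2 = theta 1 4 20 * theta 1 10 20 + fps_X ^ 2 * theta 1 6 20 * (theta 1 0 20 :: 'a fps)"
    using theta_mult[of "1 :: 'a" 1 2 2 10] by (simp add: power2_eq_square mult.assoc)
  moreover have "theta 1 5 10 ^ 2 = theta 1 10 20 * theta 1 10 20 + fps_X ^ 5 * theta 1 0 20 * (theta 1 0 20 :: 'a fps)"
    using theta_mult[of "1 :: 'a" 1 5 5 10] by (simp add: power2_eq_square mult.assoc)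
  moreover have "theta (- 1) 2 10 * theta (- 1) 4 10 = theta 1 6 20 * theta 1 8 20 - fps_X ^ 2 * theta 1 4 20 * (theta 1 2 20 :: 'a fps)"
    using theta_mult[of "- 1 :: 'a" "- 1" 2 4 10] by (simp add: mult.assoc flip: fps_const_neg)
  moreover have "(A * f - x ^ 3 * B * g) * (C * f + x ^ 4 * D * g) -
      x ^ 2 * ((D * f - x * C * g) * (B * f + x ^ 2 * A * g)) =
      (A * C - x ^ 2 * B * D) * (f * f + x ^ 5 * g * g)" for A B C D f g x :: "'a fps"
    by algebra
  ultimately show ?thesis by simp
qed

text \<open>The two products are S + T and S - T with S and T products of theta series of modulus
  20, so the difference of squares is 4 S T.\<close>

lemma theta_relation_nu:
  "(theta 1 1 10 * theta (- 1) 3 10) ^ 2 - (theta (- 1) 1 10 * theta 1 3 10) ^ 2 =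
    (4 * fps_X * theta (- 1) 2 20 * theta (- 1) 4 20 * theta (- 1) 6 20 * theta (- 1) 8 20 :: 'a::idom fps)"
proof -
  have "theta 1 1 10 * theta (- 1) 3 10 = theta (- 1) 4 20 * theta (- 1) 8 20 +
      fps_X * theta (- 1) 6 20 * (theta (- 1) 2 20 :: 'a fps)"
    using theta_mult[of "1 :: 'a" "- 1" 1 3 10] by (simp add: mult.assoc)
  moreover have "theta (- 1) 1 10 * theta 1 3 10 = theta (- 1) 4 20 * theta (- 1) 8 20 -
      fps_X * theta (- 1) 6 20 * (theta (- 1) 2 20 :: 'a fps)"
    using theta_mult[of "- 1 :: 'a" 1 1 3 10] by (simp add: mult.assoc flip: fps_const_neg)
  moreover have "(A * B + x * C * D) ^ 2 - (A * B - x * C * D) ^ 2 = 4 * x * D * A * C * B"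
    for A B C D x :: "'a fps" by algebra
  ultimately show ?thesis by simp
qed

section \<open>Reduction to products in base q^10 and the two identities\<close>

lemma qpoch_fls_dissect:
  assumes "0 < m" "0 < d"
  shows "fps_to_fls (qpoch s a m) = (\<Prod>j<d. fps_to_fls (qpoch s (a + m * j) (m * d)))"
  using qpoch_dissect[OF assms, of s a] by (simp only: fps_to_fls_prod_ring)

theorem theorem3p1:
  fixes q :: "complex fls"
  defines "q \<equiv> fls_X"
  shows "1 / mu q - mu q =
           (E (q ^ 2) ^ 3 * E (q ^ 10) ^ 5) /
           (q * E q * E (q ^ 4) * E (q ^ 5) ^ 3 * E (q ^ 20) ^ 3) \<and>
         1 / nu_sq q - nu_sq q =
           (4 * q * E (q ^ 4) * E (q ^ 20) ^ 3) / E (q ^ 10) ^ 4"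
proof -
  \<comment> \<open>Everything is expressed through \<open>p a\<close> = (q^a; q^10) and
    \<open>n a\<close> = (-q^a; q^10), which are nonzero for positive \<open>a\<close> and so may be
    cancelled.\<close>
  define P where "P = (\<lambda>a m. fps_to_fls (qpoch (1 :: complex) a m))"
  define p where "p = (\<lambda>a. P a 10)"
  define n where "n = (\<lambda>a. fps_to_fls (qpoch (- 1 :: complex) a 10))"
  have nz: "p a \<noteq> 0" "n a \<noteq> 0" if "0 < a" for a
    using qpoch_nth_0[OF that, of "1 :: complex" 10] qpoch_nth_0[OF that, of "- 1 :: complex" 10]
    by (auto simp: p_def P_def n_def)
  have q0: "q \<noteq> 0" by (simp add: q_def)
  have dissect: "P a m = (\<Prod>j<d. P (a + m * j) (m * d))" if "0 < m" "0 < d" for a m d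
    unfolding P_def using that by (rule qpoch_fls_dissect)
  have prod2: "(\<Prod>j<2. g j) = g 0 * g 1" and
    prod5: "(\<Prod>j<5. g j) = g 0 * g 1 * g 2 * g 3 * g 4" and
    prod10: "(\<Prod>j<10. g j) = g 0 * g 1 * g 2 * g 3 * g 4 * g 5 * g 6 * g 7 * g 8 * g 9"
    for g :: "nat \<Rightarrow> complex fls"
    by (simp_all add: eval_nat_numeral mult_ac)
  have P20: "P (2 * a) 20 = p a * n a" for a
    using qpoch_mult_neg[of 10 a, where ?'a = complex] by (simp add: P_def p_def n_def flip: fls_times_fps_to_fls)
  have P20s: "P 2 20 = p 1 * n 1" "P 4 20 = p 2 * n 2" "P 6 20 = p 3 * n 3" "P 8 20 = p 4 * n 4"
    "P 10 20 = p 5 * n 5" "P 12 20 = p 6 * n 6" "P 14 20 = p 7 * n 7" "P 16 20 = p 8 * n 8"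
    "P 18 20 = p 9 * n 9" "P 20 20 = p 10 * n 10"
    using P20[of 1] P20[of 2] P20[of 3] P20[of 4] P20[of 5] P20[of 6] P20[of 7] P20[of 8] P20[of 9] P20[of 10]
    by simp_all
  have P5: "P a 5 = p a * p (a + 5)" for a
    using dissect[of 5 2 a] by (simp add: p_def prod2)
  have split: "p a = P a 20 * P (a + 10) 20" for a
    using dissect[of 10 2 a] by (simp add: p_def prod2)
  have p2: "p 2 = p 1 * n 1 * (p 6 * n 6)"
    using split[of 2] by (simp add: P20s)
  have p4: "p 4 = p 2 * n 2 * (p 7 * n 7)"
    using split[of 4] by (simp add: P20s)
  have p6: "p 6 = p 3 * n 3 * (p 8 * n 8)"
    using split[of 6] by (simp add: P20s)
  have p8: "p 8 = p 4 * n 4 * (p 9 * n 9)"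
    using split[of 8] by (simp add: P20s)
  have "p 10 = p 5 * n 5 * (p 10 * n 10)"
    using split[of 10] by (simp add: P20s)
  \<comment> \<open>Euler's identity (q^5; q^10) (-q^5; q^5) = 1, obtained by cancelling
    \<open>p 10\<close>.\<close>
  then have unit: "p 5 * n 5 * n 10 = 1"
    using nz[of 10] by (simp add: mult.assoc)
  have qp: "qpoch_inf (q ^ a) (q ^ m) = P a m" if "0 < a" "0 < m" for a m
    unfolding P_def q_def using that by (rule qpoch_inf_eq_qpoch)
  have E: "E (q ^ k) = P k k" if "0 < k" for k
    unfolding E_def using that by (intro qp)
  have E1: "E q = p 1 * p 2 * p 3 * p 4 * p 5 * p 6 * p 7 * p 8 * p 9 * p 10"
    using E[of 1] dissect[of 1 10 1] by (simp add: p_def prod10 flip: numeral_2_eq_2)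
  have E2: "E (q ^ 2) = p 2 * p 4 * p 6 * p 8 * p 10"
    using E[of 2] dissect[of 2 5 2] by (simp add: p_def prod5 flip: numeral_2_eq_2)
  have E4: "E (q ^ 4) = (p 2 * n 2) * (p 4 * n 4) * (p 6 * n 6) * (p 8 * n 8) * (p 10 * n 10)"
    using E[of 4] dissect[of 4 5 4] by (simp add: P20s prod5)
  have E5: "E (q ^ 5) = p 5 * p 10"
    using E[of 5] by (simp add: P5)
  have E10: "E (q ^ 10) = p 10"
    using E[of 10] by (simp add: p_def)
  have E20: "E (q ^ 20) = p 10 * n 10"
    using E[of 20] by (simp add: P20s)
  have Rk: "R (q ^ k) = (P k (5 * k) * P (4 * k) (5 * k)) / (P (2 * k) (5 * k) * P (3 * k) (5 * k))"
    if "0 < k" for k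
    unfolding R_def using that by (simp add: qp mult.commute flip: power_mult)
  have R1: "R q = (p 1 * p 6 * (p 4 * p 9)) / (p 2 * p 7 * (p 3 * p 8))"
    using Rk[of 1] by (simp add: P5)
  have R2: "R (q ^ 2) = (p 2 * p 8) / (p 4 * p 6)"
    using Rk[of 2] by (simp add: p_def)
  have R4: "R (q ^ 4) = (p 2 * n 2 * (p 8 * n 8)) / (p 4 * n 4 * (p 6 * n 6))"
    using Rk[of 4] by (simp add: P20s)
  have th: "fps_to_fls (theta (- 1) a m) = P a m * P (m - a) m * P m m" if "0 < a" "a < m" for a m
    using jacobi_triple_product[of "- 1 :: complex" a m] that
    by (simp add: P_def flip: fls_times_fps_to_fls)
  have thn: "fps_to_fls (theta 1 a 10) = n a * n (10 - a) * p 10" if "0 < a" "a < 10" for a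
    using jacobi_triple_product[of "1 :: complex" a 10] that
    by (simp add: P_def p_def n_def flip: fls_times_fps_to_fls)
  have mu: "mu q = (q * p 1 * p 9 * n 2 * n 8) / (p 3 * p 7 * n 4 * n 6)"
    unfolding mu_def R1 R4 using nz by (simp add: divide_simps)
  \<comment> \<open>For mu = u / v the left side of the claim is (v^2 - u^2) / (u v); this computes
    the numerator. Every theta series contributes one \<open>p 10\<close>, and
    \<open>p 10 ^ 4\<close> cancels.\<close>
  have "(p 3 * p 7 * n 4 * n 6) ^ 2 - (q * p 1 * p 9 * n 2 * n 8) ^ 2 = p 2 * p 8 * p 4 * p 6 * n 5 ^ 4"
  proof -
    have "(p 3 * p 7 * p 10) ^ 2 * (n 4 * n 6 * p 10) ^ 2 - q ^ 2 * ((p 1 * p 9 * p 10) ^ 2 * (n 2 * n 8 * p 10) ^ 2) =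
        p 2 * p 8 * p 10 * (p 4 * p 6 * p 10) * (n 5 * n 5 * p 10) ^ 2"
      using arg_cong[OF theta_relation_mu[where ?'a = complex], of fps_to_fls]
      by (simp add: fls_times_fps_to_fls fps_to_fls_power th thn p_def q_def)
    then have "((p 3 * p 7 * n 4 * n 6) ^ 2 - (q * p 1 * p 9 * n 2 * n 8) ^ 2) * p 10 ^ 4 =
        (p 2 * p 8 * p 4 * p 6 * n 5 ^ 4) * p 10 ^ 4"
      by algebra
    then show ?thesis using nz[of 10] by simp
  qed
  then have 1: "1 / mu q - mu q = (p 2 * p 8 * p 4 * p 6 * n 5 ^ 4) /
      ((q * p 1 * p 9 * n 2 * n 8) * (p 3 * p 7 * n 4 * n 6))"
    unfolding mu using nz q0 by (simp add: divide_simps power2_eq_square)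
  \<comment> \<open>The only product not matched by the eta quotients is \<open>n 5 ^ 4\<close>;
    Euler's identity trades it for powers of \<open>p 5\<close> and \<open>n 10\<close>, which
    \<open>E (q ^ 5)\<close> and \<open>E (q ^ 20)\<close> supply.\<close>
  have n5: "n 5 = 1 / (p 5 * n 10)"
    using unit nz[of 5] nz[of 10] by (simp add: field_simps)
  have mu_eq: "1 / mu q - mu q = (E (q ^ 2) ^ 3 * E (q ^ 10) ^ 5) /
           (q * E q * E (q ^ 4) * E (q ^ 5) ^ 3 * E (q ^ 20) ^ 3)"
    unfolding 1 n5 E1 E2 E4 E5 E10 E20 using nz q0
    by (simp add: divide_simps) (simp add: power_numeral_reduce mult_ac)
  have nu: "nu_sq q = (p 1 * p 9 * n 3 * n 7) / (p 3 * p 7 * n 1 * n 9)"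
  proof -
    \<comment> \<open>The splittings of \<open>p 2\<close>, \<open>p 4\<close>, \<open>p 6\<close>,
      \<open>p 8\<close> refer to each other cyclically, so each is applied once. With the two
      resulting relations, both sides of the cleared equation become the product of all
      \<open>p a\<close> with a from 1 to 9 except 5.\<close>
    have "p 2 * p 8 = p 1 * n 1 * p 6 * n 6 * p 4 * n 4 * p 9 * n 9"
      by (subst p2, subst p8) (simp only: mult_ac)
    moreover have "p 4 * p 6 = p 2 * n 2 * p 7 * n 7 * p 3 * n 3 * p 8 * n 8"
      by (subst p4, subst p6) (simp only: mult_ac)
    ultimately have "(p 1 * p 6 * p 4 * p 9) ^ 2 * n 4 * n 6 * (p 3 * p 7 * n 1 * n 9) =
        (p 2 * p 7 * p 3 * p 8) ^ 2 * n 2 * n 8 * (p 1 * p 9 * n 3 * n 7)"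
      by algebra
    then show ?thesis
      unfolding nu_sq_def R1 R2 R4 using nz by (simp add: divide_simps) (simp only: mult_ac)
  qed
  \<comment> \<open>Again the numerator v^2 - u^2. The four theta series of modulus 20 each
    contribute \<open>p 10 * n 10\<close>, which explains the factor \<open>n 10 ^ 4\<close> once
    \<open>p 10 ^ 4\<close> is cancelled.\<close>
  have "(p 3 * p 7 * n 1 * n 9) ^ 2 - (p 1 * p 9 * n 3 * n 7) ^ 2 =
      4 * q * (p 1 * n 1 * p 2 * n 2 * p 3 * n 3 * p 4 * n 4 * p 6 * n 6 * p 7 * n 7 * p 8 * n 8 * p 9 * n 9) * n 10 ^ 4"
  proof -
    have "(n 1 * n 9 * p 10 * (p 3 * p 7 * p 10)) ^ 2 - (p 1 * p 9 * p 10 * (n 3 * n 7 * p 10)) ^ 2 =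
        4 * q * (p 1 * n 1 * (p 9 * n 9) * (p 10 * n 10)) * (p 2 * n 2 * (p 8 * n 8) * (p 10 * n 10)) *
          (p 3 * n 3 * (p 7 * n 7) * (p 10 * n 10)) * (p 4 * n 4 * (p 6 * n 6) * (p 10 * n 10))"
      using arg_cong[OF theta_relation_nu[where ?'a = complex], of fps_to_fls]
      by (simp add: fls_times_fps_to_fls fps_to_fls_power th thn P20s[unfolded p_def] p_def q_def)
    then have "((p 3 * p 7 * n 1 * n 9) ^ 2 - (p 1 * p 9 * n 3 * n 7) ^ 2) * p 10 ^ 4 =
      (4 * q * (p 1 * n 1 * p 2 * n 2 * p 3 * n 3 * p 4 * n 4 * p 6 * n 6 * p 7 * n 7 * p 8 * n 8 * p 9 * n 9) * n 10 ^ 4)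
      * p 10 ^ 4"
      by algebra
    then show ?thesis using nz[of 10] by simp
  qed
  then have 2: "1 / nu_sq q - nu_sq q =
      (4 * q * (p 1 * n 1 * p 2 * n 2 * p 3 * n 3 * p 4 * n 4 * p 6 * n 6 * p 7 * n 7 * p 8 * n 8 * p 9 * n 9) * n 10 ^ 4) /
      ((p 1 * p 9 * n 3 * n 7) * (p 3 * p 7 * n 1 * n 9))"
    unfolding nu using nz by (simp add: divide_simps power2_eq_square)
  have nu_eq: "1 / nu_sq q - nu_sq q = (4 * q * E (q ^ 4) * E (q ^ 20) ^ 3) / E (q ^ 10) ^ 4"
    unfolding 2 E4 E10 E20 using nz
    by (simp add: divide_simps) (simp add: power_numeral_reduce mult_ac)
  show ?thesis using mu_eq nu_eq by blast
qed

end
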